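(* Let $(M,g)$ be an $n$-dimensional $(N(k),\xi)$-semi-Riemannian manifold, let $a_0,\dots,a_7,b_0,\dots,b_7$ be real numbers, let $\ell\ge 0$ be an integer, and suppose $M$ is $(\mathcal{T}_a,\mathcal{T}_b,S^\ell)$-pseudosymmetric, i.e. $\mathcal{T}_a\cdot\mathcal{T}_b=L_{S^\ell}\,Q(S^\ell,\mathcal{T}_b)$ for a smooth function $L_{S^\ell}$ on $M$. Then for all vector fields $U,V,W,X$ on $M$: \begin{align*} &\varepsilon b_0(ka_0+k(n-1)a_4+a_7r)R(U,V,W,X)+\varepsilon a_1b_0S(X,R(U,V)W)\\ &-2k(n-1)a_3(kb_0+k(n-1)b_4+b_7r)\eta(X)\eta(U)g(V,W)\\ &-2k(n-1)a_3(-kb_0+k(n-1)b_5-b_7r)\eta(X)\eta(V)g(U,W)\\ &+\varepsilon a_1b_4S^2(X,U)g(V,W)+\varepsilon a_1b_5S^2(X,V)g(U,W)+\varepsilon a_1b_6S^2(X,W)g(U,V)\\ &-a_5(b_1+b_3)S^2(X,V)\eta(U)\eta(W)-a_5(b_1+b_2)S^2(X,W)\eta(U)\eta(V)-a_5(b_2+b_3)S^2(X,U)\eta(V)\eta(W)\\ &-2a_6b_1S^2(V,W)\eta(X)\eta(U)-2a_6b_2S^2(U,W)\eta(X)\eta(V)-2a_6b_3S^2(U,V)\eta(X)\eta(W)\\ &-2k^2(n-1)^2a_3b_6\,g(U,V)\eta(X)\eta(W)\\ &-2\big(k(n-1)a_3b_1+a_6(kb_0+k(n-1)b_4+b_7r)\big)\eta(X)\eta(U)S(V,W)\\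 &-2\big(k(n-1)a_3b_2+a_6(-kb_0+k(n-1)b_5-b_7r)\big)\eta(X)\eta(V)S(U,W)\\ &-2k(n-1)(a_3b_3+a_6b_6)S(U,V)\eta(X)\eta(W)\\ &+\varepsilon\big(b_4(ka_0+k(n-1)a_4+a_7r)-a_1(kb_0+k(n-1)b_4)\big)S(X,U)g(V,W)\\ &+\varepsilon\big(b_5(ka_0+k(n-1)a_4+a_7r)-a_1(-kb_0+k(n-1)b_5)\big)S(X,V)g(U,W)\\ &+\varepsilon b_6(ka_0+k(n-1)(a_4-a_1)+a_7r)S(X,W)g(U,V)\\ &-\varepsilon(kb_0+k(n-1)b_4)(ka_0+k(n-1)a_4+a_7r)g(X,U)g(V,W)\\ &-\varepsilon(-kb_0+k(n-1)b_5)(ka_0+k(n-1)a_4+a_7r)g(U,W)g(X,V)\\ &-\varepsilon k(n-1)b_6(ka_0+k(n-1)a_4+a_7r)g(X,W)g(U,V)\\ &-k(n-1)\big((b_2+b_3)(ka_0+k(n-1)a_4+a_7r)+(a_2+a_4)(-kb_0+k(n-1)(b_5+b_6)-b_7r)\big)g(X,U)\eta(V)\eta(W)\\ &-k(n-1)\big((b_1+b_3)(ka_0+k(n-1)a_4+a_7r)+(a_2+a_4)(kb_0+k(n-1)(b_4+b_6)+b_7r)\big)g(X,V)\eta(U)\eta(W)\\ &-\big((b_1+b_3)(-ka_0+k(n-1)(a_1+a_2)-a_7r)+(a_1+a_5)(kb_0+k(n-1)(b_4+b_6)+b_7r)\big)S(X,V)\eta(U)\eta(W)\\ &-\big((b_2+b_3)(-ka_0+k(n-1)(a_1+a_2)-a_7r)+(a_1+a_5)(-kb_0+k(n-1)(b_5+b_6)-b_7r)\big)S(X,U)\eta(V)\eta(W)\\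 &-\big((b_1+b_2)(-ka_0+k(n-1)(a_1+a_2)-a_7r)+k(n-1)(b_4+b_5)(a_1+a_5)\big)S(X,W)\eta(U)\eta(V)\\ &-k(n-1)\big(k(n-1)(b_4+b_5)(a_2+a_4)+(b_1+b_2)(ka_0+k(n-1)a_4+a_7r)\big)g(X,W)\eta(U)\eta(V)\\ =\;&L_{S^\ell}\Big(\varepsilon b_0S^\ell(R(U,V)W,X)+\varepsilon b_4S^{\ell+1}(X,U)g(V,W)+\varepsilon b_5S^{\ell+1}(X,V)g(U,W)\\ &+\varepsilon b_6S^{\ell+1}(X,W)g(U,V)-\varepsilon k(n-1)b_6S^\ell(X,W)g(U,V)\\ &+k^\ell(n-1)^\ell(-kb_0+k(n-1)(b_5+b_6)-b_7r)g(X,U)\eta(V)\eta(W)\\ &+k^\ell(n-1)^\ell(kb_0+k(n-1)(b_4+b_6)+b_7r)g(X,V)\eta(U)\eta(W)\\ &-(-kb_0+k(n-1)(b_2+b_3+b_5+b_6)-b_7r)S^\ell(X,U)\eta(V)\eta(W)\\ &-(kb_0+k(n-1)(b_1+b_3+b_4+b_6)+b_7r)S^\ell(X,V)\eta(U)\eta(W)\\ &-k(n-1)(b_1+b_2+b_4+b_5)S^\ell(X,W)\eta(U)\eta(V)\\ &+k^{\ell+1}(n-1)^{\ell+1}(b_4+b_5)g(X,W)\eta(U)\eta(V)\\ &-\varepsilon(-kb_0+k(n-1)b_5)S^\ell(X,V)g(U,W)-\varepsilon(kb_0+k(n-1)b_4)S^\ell(X,U)g(V,W)\\ &+k^\ell(n-1)^\ell(b_1+b_3)S(X,V)\eta(U)\eta(W)+k^\ell(n-1)^\ell(b_1+b_2)S(X,W)\eta(U)\eta(V)\\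 &+k^\ell(n-1)^\ell(b_2+b_3)S(X,U)\eta(V)\eta(W)\Big). \end{align*}
   Context: $(M,g)$ is an $n$-dimensional semi-Riemannian manifold; $R$ is its curvature tensor (sign convention: constant curvature $c$ means $R(X,Y)Z=c(g(Y,Z)X-g(X,Z)Y)$), $R(X,Y,Z,V)=g(R(X,Y)Z,V)$, $S(Y,Z)=\mathrm{tr}(X\mapsto R(X,Y)Z)$ the Ricci tensor, $Q$ the Ricci operator ($g(QX,Y)=S(X,Y)$), $r$ the scalar curvature. $S^\ell(X,Y)=g(Q^\ell X,Y)$ for $\ell=0,1,2,\dots$, so $S^0=g$, $S^1=S$; $k^0(n-1)^0=1$. $(N(k),\xi)$-semi-Riemannian manifold: $k$ is a real number and $\xi$ is a vector field with $g(\xi,\xi)=\varepsilon\in\{1,-1\}$ lying in the $k$-nullity distribution, i.e. $R(X,Y)\xi=k(g(Y,\xi)X-g(X,\xi)Y)$ for all $X,Y$; $\eta(X)=\varepsilon g(X,\xi)$. For real $a_0,\dots,a_7$, the $\mathcal{T}_a$-curvature tensor is $\mathcal{T}_a(X,Y)Z=a_0R(X,Y)Z+a_1S(Y,Z)X+a_2S(X,Z)Y+a_3S(X,Y)Z+a_4g(Y,Z)QX+a_5g(X,Z)QY+a_6g(X,Y)QZ+a_7r(g(Y,Z)X-g(X,Z)Y)$; $\mathcal{T}_b$ is the same with $b_i$ in place of $a_i$. For the $(1,3)$ tensor $\mathcal{T}_b$ and an endomorphism $F$: $(F\cdot\mathcal{T}_b)(U,V)W=F(\mathcal{T}_b(U,V)W)-\mathcal{T}_b(FU,V)W-\mathcal{T}_b(U,FV)W-\mathcal{T}_b(U,V)FW$.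 $\mathcal{T}_a\cdot\mathcal{T}_b$ is the tensor $(U,V,W;Z,X)\mapsto(\mathcal{T}_a(Z,X)\cdot\mathcal{T}_b)(U,V)W$, and, for a $(0,2)$ tensor $\sigma$, $Q(\sigma,\mathcal{T}_b)(U,V,W;Z,X)=((Z\wedge_\sigma X)\cdot\mathcal{T}_b)(U,V)W$ with $(Z\wedge_\sigma X)Y=\sigma(X,Y)Z-\sigma(Z,Y)X$. *)

theory Defs
  imports "HOL-Analysis.Analysis"
begin

section \<open>Smooth manifolds\<close>

text \<open>
  The distribution has no theory of smooth manifolds. A manifold is given here by a Hausdorff,
  second countable type \<open>'m\<close> of points together with an atlas of charts into \<open>real ^ 'n\<close>, so
  that its dimension is \<open>CARD('n)\<close>. Tensor fields are given in the classical way: by their local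
  representatives in the charts of the atlas, subject to the transformation law on overlaps.
\<close>

text \<open>To be used with open \<open>S\<close> and finite-dimensional domain only.\<close>

primrec Ck_on :: "nat \<Rightarrow> 'a::real_normed_vector set \<Rightarrow> ('a \<Rightarrow> 'b::real_normed_vector) \<Rightarrow> bool"
where
  "Ck_on 0 S f \<longleftrightarrow> continuous_on S f"
| "Ck_on (Suc j) S f \<longleftrightarrow>
     (\<forall>x\<in>S. f differentiable (at x)) \<and> (\<forall>v. Ck_on j S (\<lambda>x. frechet_derivative f (at x) v))"

definition smooth_on :: "'a::real_normed_vector set \<Rightarrow> ('a \<Rightarrow> 'b::real_normed_vector) \<Rightarrow> bool" where
  "smooth_on S f \<longleftrightarrow> (\<forall>j. Ck_on j S f)"

type_synonym ('m, 'n) chart = "'m set \<times> ('m \<Rightarrow> real ^ 'n)"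

definition chart_image :: "('m, 'n) chart \<Rightarrow> (real ^ 'n) set" where
  "chart_image c = snd c ` fst c"

definition chart_inv :: "('m, 'n) chart \<Rightarrow> real ^ 'n \<Rightarrow> 'm" where
  "chart_inv c = the_inv_into (fst c) (snd c)"

definition is_chart :: "('m::topological_space, 'n::finite) chart \<Rightarrow> bool" where
  "is_chart c \<longleftrightarrow> open (fst c) \<and> open (chart_image c) \<and> inj_on (snd c) (fst c) \<and>
     homeomorphism (fst c) (chart_image c) (snd c) (chart_inv c)"

definition overlap :: "('m, 'n) chart \<Rightarrow> ('m, 'n) chart \<Rightarrow> (real ^ 'n) set" where
  "overlap c d = snd c ` (fst c \<inter> fst d)"

definition transition :: "('m, 'n) chart \<Rightarrow> ('m, 'n) chart \<Rightarrow> real ^ 'n \<Rightarrow> real ^ 'n" where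
  "transition c d = snd d \<circ> chart_inv c"

definition smooth_atlas ::
  "('m::{t2_space, second_countable_topology}, 'n::finite) chart set \<Rightarrow> bool" where
  "smooth_atlas A \<longleftrightarrow> (\<forall>c\<in>A. is_chart c) \<and> (\<Union>c\<in>A. fst c) = UNIV \<and>
     (\<forall>c\<in>A. \<forall>d\<in>A. smooth_on (overlap c d) (transition c d))"

definition smooth_function :: "('m, 'n::finite) chart set \<Rightarrow> ('m \<Rightarrow> real) \<Rightarrow> bool" where
  "smooth_function A f \<longleftrightarrow> (\<forall>c\<in>A. smooth_on (chart_image c) (f \<circ> chart_inv c))"

text \<open>\<open>X c x\<close> is the vector of components, in the chart \<open>c\<close>, of the field at the point with
  coordinates \<open>x\<close>.\<close>

type_synonym ('m, 'n) vfield = "('m, 'n) chart \<Rightarrow> real ^ 'n \<Rightarrow> real ^ 'n"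

definition smooth_vector_field :: "('m, 'n::finite) chart set \<Rightarrow> ('m, 'n) vfield \<Rightarrow> bool" where
  "smooth_vector_field A X \<longleftrightarrow> (\<forall>c\<in>A. smooth_on (chart_image c) (X c)) \<and>
     (\<forall>c\<in>A. \<forall>d\<in>A. \<forall>x\<in>overlap c d.
        X d (transition c d x) = frechet_derivative (transition c d) (at x) (X c x))"


section \<open>Semi-Riemannian metrics\<close>

text \<open>\<open>g c x u v\<close> is the scalar product of the tangent vectors with components \<open>u\<close>, \<open>v\<close>.\<close>

type_synonym 'n local_metric = "real ^ 'n \<Rightarrow> real ^ 'n \<Rightarrow> real ^ 'n \<Rightarrow> real"
type_synonym ('m, 'n) metric = "('m, 'n) chart \<Rightarrow> 'n local_metric"

definition scalar_product :: "(real ^ 'n \<Rightarrow> real ^ 'n \<Rightarrow> real) \<Rightarrow> bool" where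
  "scalar_product B \<longleftrightarrow> bilinear B \<and> (\<forall>u v. B u v = B v u) \<and> (\<forall>u. (\<forall>v. B u v = 0) \<longrightarrow> u = 0)"

definition metric_index :: "(real ^ 'n::finite \<Rightarrow> real ^ 'n \<Rightarrow> real) \<Rightarrow> nat" where
  "metric_index B = Max {dim S |S. subspace S \<and> (\<forall>v\<in>S. v \<noteq> 0 \<longrightarrow> B v v < 0)}"

definition semi_riemannian_metric ::
  "('m, 'n::finite) chart set \<Rightarrow> ('m, 'n) metric \<Rightarrow> bool" where
  "semi_riemannian_metric A g \<longleftrightarrow>
     (\<forall>c\<in>A. \<forall>x\<in>chart_image c. scalar_product (g c x)) \<and>
     (\<exists>\<nu>. \<forall>c\<in>A. \<forall>x\<in>chart_image c. metric_index (g c x) = \<nu>) \<and>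
     (\<forall>c\<in>A. \<forall>u v. smooth_on (chart_image c) (\<lambda>x. g c x u v)) \<and>
     (\<forall>c\<in>A. \<forall>d\<in>A. \<forall>x\<in>overlap c d. \<forall>u v.
        g d (transition c d x) (frechet_derivative (transition c d) (at x) u)
          (frechet_derivative (transition c d) (at x) v) = g c x u v)"

definition semi_riemannian_manifold ::
  "('m::{t2_space, second_countable_topology}, 'n::finite) chart set \<Rightarrow> ('m, 'n) metric \<Rightarrow> bool"
where
  "semi_riemannian_manifold A g \<longleftrightarrow> smooth_atlas A \<and> semi_riemannian_metric A g"


section \<open>Levi-Civita connection and curvature in a chart\<close>

text \<open>
  In this section \<open>h\<close> is the representative of the metric in one chart.
  \<open>christoffel h x u v\<close> has the components \<open>\<Gamma>\<^sup>m\<^sub>i\<^sub>j u\<^sup>i v\<^sup>j\<close>, defined by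
  \<open>2 h\<^sub>m\<^sub>l \<Gamma>\<^sup>m\<^sub>i\<^sub>j = \<partial>\<^sub>i h\<^sub>j\<^sub>l + \<partial>\<^sub>j h\<^sub>i\<^sub>l - \<partial>\<^sub>l h\<^sub>i\<^sub>j\<close>.
\<close>

definition christoffel :: "'n::finite local_metric \<Rightarrow> real ^ 'n \<Rightarrow> real ^ 'n \<Rightarrow> real ^ 'n \<Rightarrow> real ^ 'n"
where
  "christoffel h x u v = (THE z. \<forall>w. 2 * h x z w =
     frechet_derivative (\<lambda>y. h y v w) (at x) u + frechet_derivative (\<lambda>y. h y u w) (at x) v
       - frechet_derivative (\<lambda>y. h y u v) (at x) w)"

definition cov_deriv ::
  "'n::finite local_metric \<Rightarrow> (real ^ 'n \<Rightarrow> real ^ 'n) \<Rightarrow> (real ^ 'n \<Rightarrow> real ^ 'n) \<Rightarrow> real ^ 'n \<Rightarrow> real ^ 'n"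
where
  "cov_deriv h X Y x = frechet_derivative Y (at x) (X x) + christoffel h x (X x) (Y x)"

definition lie_bracket ::
  "(real ^ 'n::finite \<Rightarrow> real ^ 'n) \<Rightarrow> (real ^ 'n \<Rightarrow> real ^ 'n) \<Rightarrow> real ^ 'n \<Rightarrow> real ^ 'n" where
  "lie_bracket X Y x = frechet_derivative Y (at x) (X x) - frechet_derivative X (at x) (Y x)"

definition curvature_field ::
  "'n::finite local_metric \<Rightarrow> (real ^ 'n \<Rightarrow> real ^ 'n) \<Rightarrow> (real ^ 'n \<Rightarrow> real ^ 'n) \<Rightarrow>
     (real ^ 'n \<Rightarrow> real ^ 'n) \<Rightarrow> real ^ 'n \<Rightarrow> real ^ 'n" where
  "curvature_field h X Y Z x = cov_deriv h X (cov_deriv h Y Z) x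
     - cov_deriv h Y (cov_deriv h X Z) x - cov_deriv h (lie_bracket X Y) Z x"

text \<open>
  The value of \<open>R(X,Y)Z\<close> at a point depends only on the values of \<open>X\<close>, \<open>Y\<close>, \<open>Z\<close> there, so the
  curvature tensor at \<open>x\<close> is evaluated on tangent vectors by extending these with constant
  components in the chart.
\<close>

definition Riem ::
  "'n::finite local_metric \<Rightarrow> real ^ 'n \<Rightarrow> real ^ 'n \<Rightarrow> real ^ 'n \<Rightarrow> real ^ 'n \<Rightarrow> real ^ 'n" where
  "Riem h x u v w = curvature_field h (\<lambda>_. u) (\<lambda>_. v) (\<lambda>_. w) x"

definition Ric :: "'n::finite local_metric \<Rightarrow> real ^ 'n \<Rightarrow> real ^ 'n \<Rightarrow> real ^ 'n \<Rightarrow> real" where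
  "Ric h x v w = trace (matrix (\<lambda>u. Riem h x u v w))"

definition Ric_op :: "'n::finite local_metric \<Rightarrow> real ^ 'n \<Rightarrow> real ^ 'n \<Rightarrow> real ^ 'n" where
  "Ric_op h x u = (THE z. \<forall>v. h x z v = Ric h x u v)"

definition scal :: "'n::finite local_metric \<Rightarrow> real ^ 'n \<Rightarrow> real" where
  "scal h x = trace (matrix (Ric_op h x))"

definition Ric_pow :: "'n::finite local_metric \<Rightarrow> real ^ 'n \<Rightarrow> nat \<Rightarrow> real ^ 'n \<Rightarrow> real ^ 'n \<Rightarrow> real" where
  "Ric_pow h x l u v = h x ((Ric_op h x ^^ l) u) v"

definition T_curv ::
  "(nat \<Rightarrow> real) \<Rightarrow> 'n::finite local_metric \<Rightarrow> real ^ 'n \<Rightarrow> real ^ 'n \<Rightarrow> real ^ 'n \<Rightarrow> real ^ 'n \<Rightarrow> real ^ 'n"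
where
  "T_curv a h x X Y Z =
     a 0 *\<^sub>R Riem h x X Y Z
     + (a 1 * Ric h x Y Z) *\<^sub>R X + (a 2 * Ric h x X Z) *\<^sub>R Y + (a 3 * Ric h x X Y) *\<^sub>R Z
     + (a 4 * h x Y Z) *\<^sub>R Ric_op h x X + (a 5 * h x X Z) *\<^sub>R Ric_op h x Y
     + (a 6 * h x X Y) *\<^sub>R Ric_op h x Z
     + (a 7 * scal h x) *\<^sub>R (h x Y Z *\<^sub>R X - h x X Z *\<^sub>R Y)"


section \<open>Pseudosymmetry and the nullity condition\<close>

definition derivation_act ::
  "('v \<Rightarrow> 'v) \<Rightarrow> ('v \<Rightarrow> 'v \<Rightarrow> 'v \<Rightarrow> 'v) \<Rightarrow> 'v \<Rightarrow> 'v \<Rightarrow> 'v \<Rightarrow> 'v::real_vector" where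
  "derivation_act F T U V W = F (T U V W) - T (F U) V W - T U (F V) W - T U V (F W)"

definition wedge :: "('v \<Rightarrow> 'v \<Rightarrow> real) \<Rightarrow> 'v \<Rightarrow> 'v \<Rightarrow> 'v \<Rightarrow> 'v::real_vector" where
  "wedge \<sigma> Z X Y = \<sigma> X Y *\<^sub>R Z - \<sigma> Z Y *\<^sub>R X"

text \<open>
  \<open>T\<^sub>a \<cdot> T\<^sub>b = L Q(S\<^sup>l, T\<^sub>b)\<close>, an equality of tensor fields, hence stated for all tangent vectors
  at all points.
\<close>

definition pseudosymmetric ::
  "('m, 'n::finite) chart set \<Rightarrow> ('m, 'n) metric \<Rightarrow> (nat \<Rightarrow> real) \<Rightarrow> (nat \<Rightarrow> real) \<Rightarrow> nat \<Rightarrow>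
     ('m \<Rightarrow> real) \<Rightarrow> bool" where
  "pseudosymmetric A g a b l L \<longleftrightarrow> smooth_function A L \<and>
     (\<forall>c\<in>A. \<forall>p\<in>fst c. let h = g c; x = snd c p in
        \<forall>U V W Z X. derivation_act (T_curv a h x Z X) (T_curv b h x) U V W
          = L p *\<^sub>R derivation_act (wedge (Ric_pow h x l) Z X) (T_curv b h x) U V W)"

definition in_nullity :: "real \<Rightarrow> 'n::finite local_metric \<Rightarrow> real ^ 'n \<Rightarrow> real ^ 'n \<Rightarrow> bool" where
  "in_nullity k h x z \<longleftrightarrow> (\<forall>X Y. Riem h x X Y z = k *\<^sub>R (h x Y z *\<^sub>R X - h x X z *\<^sub>R Y))"

definition N_k_xi_manifold ::
  "('m::{t2_space, second_countable_topology}, 'n::finite) chart set \<Rightarrow> ('m, 'n) metric \<Rightarrow>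
     real \<Rightarrow> ('m, 'n) vfield \<Rightarrow> real \<Rightarrow> bool" where
  "N_k_xi_manifold A g k \<xi> \<epsilon> \<longleftrightarrow> semi_riemannian_manifold A g \<and> smooth_vector_field A \<xi> \<and>
     \<epsilon> \<in> {1, -1} \<and>
     (\<forall>c\<in>A. \<forall>x\<in>chart_image c. g c x (\<xi> c x) (\<xi> c x) = \<epsilon> \<and> in_nullity k (g c) x (\<xi> c x))"

end

theory Submission
  imports Defs
begin

text \<open>
  The identity is the \<open>\<xi>\<close>-component of the pseudosymmetry condition, evaluated with its first vector
  equal to \<open>\<xi>\<close>: from \<open>(T\<^sub>a(\<xi>,X) \<cdot> T\<^sub>b)(U,V)W = L ((\<xi> \<and> X) \<cdot> T\<^sub>b)(U,V)W\<close>, where the wedge product is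
  formed with \<open>S\<^sup>l\<close>, one takes the scalar product with \<open>\<xi>\<close> and computes both sides.

  The computation rests on how the curvature behaves at \<open>\<xi>\<close>. The nullity condition prescribes
  \<open>R(X,Y)\<xi>\<close>. Skewness of \<open>g(R(X,Y)Z,V)\<close> in \<open>Z\<close> and \<open>V\<close> turns this into a formula for \<open>g(R(X,Y)Z,\<xi>)\<close>
  (\<open>metric_Riem_unit\<close>), pair symmetry into \<open>R(\<xi>,X)Y = k(g(X,Y)\<xi> - g(Y,\<xi>)X)\<close> (\<open>Riem_unit_left\<close>), and
  taking the trace gives \<open>S(X,\<xi>) = k(n-1)g(X,\<xi>)\<close>, so that \<open>\<xi>\<close> is an eigenvector of the Ricci operator
  and of its powers (\<open>Ric_op_unit\<close>, \<open>Ric_pow_unit_left\<close>). Hence \<open>g(T\<^sub>b(U,V)W,\<xi>)\<close> contains no curvature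
  tensor any more, only \<open>g\<close>, \<open>S\<close> and \<open>\<eta>\<close> (\<open>T_curv_unit\<close>), and likewise the endomorphisms \<open>T\<^sub>a(\<xi>,X)\<close>
  (\<open>T_curv_unit_left\<close>) and \<open>\<xi> \<and> X\<close> (\<open>wedge_unit_left\<close>). What remains of the two sides
  (\<open>derivation_inner_unit\<close>) are polynomials in the values of \<open>g\<close>, of the powers of \<open>S\<close> and of \<open>\<eta>\<close>, and
  they are compared by ring normalization.

  The symmetries of the curvature tensor have to be derived from its definition in coordinates. The
  connection is determined by the Koszul formula and differentiable by Cramer's rule
  (\<open>christoffel_differentiable\<close>). Its symmetry yields the first Bianchi identity (\<open>bianchi\<close>), its
  compatibility with the metric, together with the equality of mixed second derivatives
  (\<open>mixed_derivatives_commute\<close>), yields skewness in the last two arguments (\<open>Riem_metric_skew\<close>), and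
  the two together yield pair symmetry (\<open>Riem_pair_sym\<close>). The Ricci tensor is symmetric because, by
  the Bianchi identity, its skew part is the trace of a skew endomorphism (\<open>Ric_sym\<close>).
\<close>

section \<open>Equality of mixed derivatives\<close>

lemma has_real_derivative_along_line:
  fixes f :: "'a::real_normed_vector \<Rightarrow> real"
  assumes "f differentiable (at (p + t *\<^sub>R u))"
  shows "((\<lambda>t. f (p + t *\<^sub>R u)) has_real_derivative
           frechet_derivative f (at (p + t *\<^sub>R u)) u) (at t)"
proof -
  let ?D = "frechet_derivative f (at (p + t *\<^sub>R u))"
  have D: "(f has_derivative ?D) (at (p + t *\<^sub>R u))"
    using assms frechet_derivative_works by blast
  have "((\<lambda>t. p + t *\<^sub>R u) has_derivative (\<lambda>s. s *\<^sub>R u)) (at t)"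
    by (auto intro!: derivative_eq_intros)
  from has_derivative_compose[OF this D]
  have "((\<lambda>t. f (p + t *\<^sub>R u)) has_derivative (\<lambda>s. ?D (s *\<^sub>R u))) (at t)" .
  moreover have "(\<lambda>s. ?D (s *\<^sub>R u)) = (*) (?D u)"
    using linear_scale[OF linear_frechet_derivative[OF assms]] by (auto simp: mult.commute)
  ultimately show ?thesis by (simp add: has_field_derivative_def)
qed

text \<open>
  The mean value theorem, applied first to the increment of \<open>f\<close> in direction \<open>v\<close> as a function of
  the displacement along \<open>u\<close> and then to \<open>\<partial>\<^sub>u f\<close> along \<open>v\<close>. The left-hand side of the final equation is
  symmetric in \<open>u\<close> and \<open>v\<close>; the right-hand side is not, and this is what forces the mixed
  derivatives to agree in the limit \<open>s \<rightarrow> 0\<close>.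
\<close>
lemma second_difference_mean_value:
  fixes f :: "'a::real_normed_vector \<Rightarrow> real"
  assumes "0 < s"
    and D: "\<And>\<theta> \<eta>. 0 \<le> \<theta> \<Longrightarrow> \<theta> \<le> s \<Longrightarrow> 0 \<le> \<eta> \<Longrightarrow> \<eta> \<le> s \<Longrightarrow> p + \<theta> *\<^sub>R u + \<eta> *\<^sub>R v \<in> D"
    and diff: "\<And>y. y \<in> D \<Longrightarrow> f differentiable (at y)"
    and diff2: "\<And>y. y \<in> D \<Longrightarrow> (\<lambda>y. frechet_derivative f (at y) u) differentiable (at y)"
  obtains \<theta> \<eta> where "0 < \<theta>" "\<theta> < s" "0 < \<eta>" "\<eta> < s"
    "f (p + s *\<^sub>R u + s *\<^sub>R v) - f (p + s *\<^sub>R u) - f (p + s *\<^sub>R v) + f p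
       = s\<^sup>2 * frechet_derivative (\<lambda>y. frechet_derivative f (at y) u) (at (p + \<theta> *\<^sub>R u + \<eta> *\<^sub>R v)) v"
proof -
  let ?f' = "\<lambda>y. frechet_derivative f (at y) u"
  let ?\<phi> = "\<lambda>t. f ((p + s *\<^sub>R v) + t *\<^sub>R u) - f (p + t *\<^sub>R u)"
  have "(?\<phi> has_real_derivative (?f' ((p + s *\<^sub>R v) + t *\<^sub>R u) - ?f' (p + t *\<^sub>R u))) (at t)"
    if "0 \<le> t" "t \<le> s" for t
    using D[OF that, of s] D[OF that, of 0] \<open>0 < s\<close>
    by (intro DERIV_diff has_real_derivative_along_line diff) (auto simp: algebra_simps)
  from MVT2[OF \<open>0 < s\<close> this] obtain \<theta> where \<theta>: "0 < \<theta>" "\<theta> < s"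
    and eq1: "?\<phi> s - ?\<phi> 0 = s * (?f' ((p + s *\<^sub>R v) + \<theta> *\<^sub>R u) - ?f' (p + \<theta> *\<^sub>R u))"
    by auto
  have "((\<lambda>t. ?f' ((p + \<theta> *\<^sub>R u) + t *\<^sub>R v)) has_real_derivative
          frechet_derivative ?f' (at ((p + \<theta> *\<^sub>R u) + t *\<^sub>R v)) v) (at t)"
    if "0 \<le> t" "t \<le> s" for t
    using D[of \<theta> t] \<theta> that by (intro has_real_derivative_along_line diff2) auto
  from MVT2[OF \<open>0 < s\<close> this] obtain \<eta> where \<eta>: "0 < \<eta>" "\<eta> < s"
    and eq2: "?f' ((p + \<theta> *\<^sub>R u) + s *\<^sub>R v) - ?f' (p + \<theta> *\<^sub>R u)
          = s * frechet_derivative ?f' (at ((p + \<theta> *\<^sub>R u) + \<eta> *\<^sub>R v)) v"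
    by auto
  have "f (p + s *\<^sub>R u + s *\<^sub>R v) - f (p + s *\<^sub>R u) - f (p + s *\<^sub>R v) + f p = ?\<phi> s - ?\<phi> 0"
    by (simp add: algebra_simps)
  also have "\<dots> = s * (?f' ((p + \<theta> *\<^sub>R u) + s *\<^sub>R v) - ?f' (p + \<theta> *\<^sub>R u))"
    unfolding eq1 by (simp add: algebra_simps)
  also have "\<dots> = s\<^sup>2 * frechet_derivative ?f' (at ((p + \<theta> *\<^sub>R u) + \<eta> *\<^sub>R v)) v"
    unfolding eq2 by (simp add: power2_eq_square)
  finally show ?thesis using that \<theta> \<eta> by blast
qed

text \<open>
  If the two mixed derivatives at \<open>x\<close> differed by \<open>2e\<close>, continuity would keep each of them within \<open>e\<close>
  of its value at \<open>x\<close> on a small ball; but the second difference equals \<open>s\<^sup>2\<close> times either of them,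
  evaluated at suitable points of that ball.
\<close>
theorem mixed_derivatives_commute:
  fixes f :: "'a::real_normed_vector \<Rightarrow> real"
  assumes f: "Ck_on 2 D f" and "open D" and "x \<in> D"
  shows "frechet_derivative (\<lambda>y. frechet_derivative f (at y) u) (at x) v
       = frechet_derivative (\<lambda>y. frechet_derivative f (at y) v) (at x) u"
proof (rule ccontr)
  let ?P = "\<lambda>u v x. frechet_derivative (\<lambda>y. frechet_derivative f (at y) u) (at x) v"
  assume neq: "?P u v x \<noteq> ?P v u x"
  define e where "e = \<bar>?P u v x - ?P v u x\<bar> / 2"
  have "e > 0" using neq by (simp add: e_def)
  have diff: "f differentiable (at y)"
    and diff2: "(\<lambda>y. frechet_derivative f (at y) a) differentiable (at y)" if "y \<in> D" for y a
    using f that by (simp_all add: numeral_2_eq_2)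
  have cont: "continuous_on D (?P a b)" for a b
    using f by (simp add: numeral_2_eq_2)
  have "\<exists>\<delta>>0. ball x \<delta> \<subseteq> D \<and> (\<forall>y\<in>ball x \<delta>. \<bar>?P a b y - ?P a b x\<bar> < e)" for a b
  proof -
    have "isCont (?P a b) x"
      using cont \<open>open D\<close> \<open>x \<in> D\<close> continuous_on_eq_continuous_at by blast
    then obtain d where "d > 0" "\<And>y. dist y x < d \<Longrightarrow> \<bar>?P a b y - ?P a b x\<bar> < e"
      using \<open>e > 0\<close> unfolding continuous_at_eps_delta dist_real_def by blast
    moreover obtain d' where "d' > 0" "ball x d' \<subseteq> D"
      using \<open>open D\<close> \<open>x \<in> D\<close> open_contains_ball by blast
    ultimately show ?thesis
      by (intro exI[of _ "min d d'"]) (auto simp: dist_commute)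
  qed
  then obtain \<delta>1 \<delta>2 where \<delta>: "\<delta>1 > 0" "\<delta>2 > 0" "ball x \<delta>1 \<subseteq> D"
    and near1: "\<And>y. y \<in> ball x \<delta>1 \<Longrightarrow> \<bar>?P u v y - ?P u v x\<bar> < e"
    and near2: "\<And>y. y \<in> ball x \<delta>2 \<Longrightarrow> \<bar>?P v u y - ?P v u x\<bar> < e"
    by meson
  define \<delta> where "\<delta> = min \<delta>1 \<delta>2"
  \<comment> \<open>chosen so that the parallelogram spanned by \<open>s u\<close> and \<open>s v\<close> at \<open>x\<close> stays in the ball\<close>
  define s where "s = \<delta> / (2 * (norm u + norm v + 1))"
  have "\<delta> > 0" "s > 0" using \<delta> by (auto simp: \<delta>_def s_def add_nonneg_pos)
  have inball: "x + \<theta> *\<^sub>R u + \<eta> *\<^sub>R v \<in> ball x \<delta>" if "0 \<le> \<theta>" "\<theta> \<le> s" "0 \<le> \<eta>" "\<eta> \<le> s" for \<theta> \<eta>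
  proof -
    have "norm (\<theta> *\<^sub>R u + \<eta> *\<^sub>R v) \<le> \<theta> * norm u + \<eta> * norm v"
      by (rule order_trans[OF norm_triangle_ineq]) (use that in simp)
    also have "\<dots> \<le> s * norm u + s * norm v"
      using that by (intro add_mono mult_right_mono) auto
    also have "\<dots> < s * (2 * (norm u + norm v + 1))"
      using \<open>s > 0\<close> by (simp add: algebra_simps add_nonneg_pos)
    also have "\<dots> = \<delta>"
      by (simp add: s_def add_nonneg_eq_0_iff)
    finally have "norm (\<theta> *\<^sub>R u + \<eta> *\<^sub>R v) < \<delta>" .
    then show ?thesis by (simp add: dist_norm norm_minus_commute add.assoc algebra_simps)
  qed
  have inball': "x + \<theta> *\<^sub>R v + \<eta> *\<^sub>R u \<in> ball x \<delta>" if "0 \<le> \<theta>" "\<theta> \<le> s" "0 \<le> \<eta>" "\<eta> \<le> s" for \<theta> \<eta>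
    using inball[of \<eta> \<theta>] that by (simp add: add.commute add.left_commute)
  have diffb: "f differentiable (at y)"
    and diffb2: "(\<lambda>y. frechet_derivative f (at y) a) differentiable (at y)" if "y \<in> ball x \<delta>" for y a
    using that \<delta>(3) by (auto simp: \<delta>_def intro!: diff diff2)
  obtain \<theta> \<eta> where 1: "0 < \<theta>" "\<theta> < s" "0 < \<eta>" "\<eta> < s"
    "f (x + s *\<^sub>R u + s *\<^sub>R v) - f (x + s *\<^sub>R u) - f (x + s *\<^sub>R v) + f x
       = s\<^sup>2 * ?P u v (x + \<theta> *\<^sub>R u + \<eta> *\<^sub>R v)"
    by (rule second_difference_mean_value[OF \<open>0 < s\<close> inball diffb diffb2]) 
  obtain \<theta>' \<eta>' where 2: "0 < \<theta>'" "\<theta>' < s" "0 < \<eta>'" "\<eta>' < s"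
    "f (x + s *\<^sub>R v + s *\<^sub>R u) - f (x + s *\<^sub>R v) - f (x + s *\<^sub>R u) + f x
       = s\<^sup>2 * ?P v u (x + \<theta>' *\<^sub>R v + \<eta>' *\<^sub>R u)"
    by (rule second_difference_mean_value[OF \<open>0 < s\<close> inball' diffb diffb2]) 
  let ?y = "x + \<theta> *\<^sub>R u + \<eta> *\<^sub>R v" and ?y' = "x + \<eta>' *\<^sub>R u + \<theta>' *\<^sub>R v"
  have swap: "x + \<theta> *\<^sub>R v + \<eta> *\<^sub>R u = x + \<eta> *\<^sub>R u + \<theta> *\<^sub>R v" for \<theta> \<eta> by simp
  have "s\<^sup>2 * ?P u v ?y = s\<^sup>2 * ?P v u ?y'"
    using 1(5) 2(5)[unfolded swap] by linarith
  then have eq: "?P u v ?y = ?P v u ?y'" using \<open>s > 0\<close> by simp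
  have "\<bar>?P u v ?y - ?P u v x\<bar> < e" "\<bar>?P v u ?y' - ?P v u x\<bar> < e"
    using near1[of ?y] near2[of ?y'] inball[of \<theta> \<eta>] inball[of \<eta>' \<theta>'] 1 2
    by (auto simp: \<delta>_def)
  with eq have "\<bar>?P u v x - ?P v u x\<bar> < 2 * e" by linarith
  then show False by (simp add: e_def)
qed

section \<open>Scalar products and traces\<close>

lemma scalar_product_left_linear: "scalar_product B \<Longrightarrow> linear (\<lambda>u. B u v)"
  and scalar_product_right_linear: "scalar_product B \<Longrightarrow> linear (B u)"
  unfolding scalar_product_def bilinear_def by blast+

lemma scalar_product_sym: "scalar_product B \<Longrightarrow> B u v = B v u"
  unfolding scalar_product_def by blast

lemma scalar_product_eqI:
  assumes B: "scalar_product B" and eq: "\<And>w. B u w = B v w"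
  shows "u = v"
proof -
  have "B (u - v) w = 0" for w
    using eq by (simp add: linear_diff[OF scalar_product_left_linear[OF B]])
  then have "u - v = 0" using B unfolding scalar_product_def by blast
  then show ?thesis by simp
qed

lemma linear_real_eq_sum_axis:
  fixes f :: "real ^ 'n \<Rightarrow> 'b::real_vector"
  assumes "linear f"
  shows "f v = (\<Sum>i\<in>UNIV. v $ i *\<^sub>R f (axis i 1))"
proof -
  have "f v = f (\<Sum>i\<in>UNIV. v $ i *\<^sub>R axis i 1)"
    by (simp add: basis_expansion flip: scalar_mult_eq_scaleR)
  then show ?thesis by (simp add: linear_sum[OF assms] linear_scale[OF assms])
qed

text \<open>
  Nondegeneracy makes \<open>z \<mapsto> B z \<cdot>\<close> injective, hence, in finite dimension, onto the dual space. Thus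
  the definite descriptions in the definitions of the Christoffel map and of the Ricci operator denote.
\<close>
lemma scalar_product_riesz:
  fixes B :: "real ^ 'n \<Rightarrow> real ^ 'n \<Rightarrow> real"
  assumes B: "scalar_product B" and \<phi>: "linear \<phi>"
  shows "\<exists>!z. \<forall>w. B z w = \<phi> w"
proof -
  let ?K = "\<lambda>z. (\<chi> i. B z (axis i 1)) :: real ^ 'n"
  note lin = scalar_product_left_linear[OF B] scalar_product_right_linear[OF B]
  have lK: "linear ?K"
    by (rule linearI) (simp_all add: vec_eq_iff linear_add[OF lin(1)] linear_scale[OF lin(1)])
  have det: "B z w = \<psi> w" if "linear \<psi>" "?K z = (\<chi> i. \<psi> (axis i 1))" for z w \<psi>
    unfolding linear_real_eq_sum_axis[OF lin(2)[of z], of w] linear_real_eq_sum_axis[OF that(1), of w]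
    using that(2) by (simp add: vec_eq_iff)
  have "inj ?K"
  proof (rule injI)
    fix z z' assume "?K z = ?K z'"
    then have "B z w = B z' w" for w by (rule det[OF lin(2)])
    then show "z = z'" by (rule scalar_product_eqI[OF B])
  qed
  then have "surj ?K" using lK linear_injective_imp_surjective by blast
  from surjD[OF this, of "\<chi> i. \<phi> (axis i 1)"]
  obtain z where "?K z = (\<chi> i. \<phi> (axis i 1))" by (elim exE) (rule that, rule sym)
  then have "\<forall>w. B z w = \<phi> w" using det[OF \<phi>] by blast
  moreover have "z' = z" if "\<forall>w. B z' w = \<phi> w" for z'
    by (rule scalar_product_eqI[OF B]) (use that \<open>\<forall>w. B z w = \<phi> w\<close> in simp)
  ultimately show ?thesis by blast
qed

definition gram :: "(real ^ 'n \<Rightarrow> real ^ 'n \<Rightarrow> real) \<Rightarrow> real ^ 'n ^ 'n" where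
  "gram B = (\<chi> i j. B (axis i 1) (axis j 1))"

lemma gram_mult: "scalar_product B \<Longrightarrow> (gram B *v v) $ i = B (axis i 1) v"
  using linear_real_eq_sum_axis[OF scalar_product_right_linear, of B "axis i 1" v]
  by (simp add: gram_def matrix_vector_mult_def mult.commute)

lemma gram_det_nonzero:
  assumes B: "scalar_product B" shows "det (gram B) \<noteq> 0"
proof -
  have "v = 0" if "gram B *v v = 0" for v
  proof (rule scalar_product_eqI[OF B])
    fix w
    have "B (axis i 1) v = 0" for i using that gram_mult[OF B, of v i] by simp
    then have "B w v = 0"
      using linear_real_eq_sum_axis[OF scalar_product_left_linear[OF B, of v], of w] by simp
    then show "B v w = B 0 w"
      by (simp add: scalar_product_sym[OF B, of v] linear_0[OF scalar_product_left_linear[OF B]])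
  qed
  then show ?thesis
    using matrix_left_invertible_ker[of "gram B"] invertible_left_inverse[of "gram B"]
    by (simp flip: invertible_det_nz)
qed

lemma trace_diff:
  "trace (matrix (\<lambda>u. f u - g u :: real ^ 'n)) = trace (matrix f) - trace (matrix g)"
  by (simp add: trace_def matrix_def sum_subtractf)

lemma trace_homothety: "trace (matrix (\<lambda>u. c *\<^sub>R u :: real ^ 'n::finite)) = c * real CARD('n)"
  by (simp add: trace_def matrix_def)

lemma trace_rank_one:
  fixes \<phi> :: "real ^ 'n \<Rightarrow> real"
  assumes "linear \<phi>" shows "trace (matrix (\<lambda>u. \<phi> u *\<^sub>R y)) = \<phi> y"
  using linear_real_eq_sum_axis[OF assms, of y] by (simp add: trace_def matrix_def mult.commute)

text \<open>
  If \<open>H\<close> is the Gram matrix, then skewness of \<open>F\<close> reads \<open>H F = - F\<^sup>T H\<close>, so \<open>F\<close> is similar to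
  \<open>- F\<^sup>T\<close>.
\<close>
lemma trace_skew:
  fixes F :: "real ^ 'n \<Rightarrow> real ^ 'n"
  assumes B: "scalar_product B" and F: "linear F" and skew: "\<And>u v. B (F u) v = - B u (F v)"
  shows "trace (matrix F) = 0"
proof -
  let ?H = "gram B" and ?F = "matrix F"
  obtain K where K: "K ** ?H = mat 1" "?H ** K = mat 1"
    using gram_det_nonzero[OF B] by (auto simp: invertible_def simp flip: invertible_det_nz)
  have "(?H ** ?F) $ i $ j = - (transpose ?F ** ?H) $ i $ j" for i j
  proof -
    have "(?H ** ?F) $ i $ j = (\<Sum>k\<in>UNIV. F (axis j 1) $ k * B (axis i 1) (axis k 1))"
      by (simp add: matrix_matrix_mult_def matrix_def gram_def mult.commute)
    also have "\<dots> = B (axis i 1) (F (axis j 1))"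
      using linear_real_eq_sum_axis[OF scalar_product_right_linear[OF B], of "axis i 1" "F (axis j 1)"]
      by simp
    also have "\<dots> = - B (F (axis i 1)) (axis j 1)" using skew by simp
    also have "B (F (axis i 1)) (axis j 1) = (\<Sum>k\<in>UNIV. F (axis i 1) $ k * B (axis k 1) (axis j 1))"
      using linear_real_eq_sum_axis[OF scalar_product_left_linear[OF B, of "axis j 1"], of "F (axis i 1)"]
      by simp
    also have "\<dots> = (transpose ?F ** ?H) $ i $ j"
      by (simp add: matrix_matrix_mult_def transpose_def matrix_def gram_def)
    finally show ?thesis .
  qed
  then have HF: "?H ** ?F = - (transpose ?F ** ?H)" by (simp add: vec_eq_iff)
  have neg: "(- M) ** K = - (M ** K)" for M :: "real ^ 'n ^ 'n"
    by (simp add: vec_eq_iff matrix_matrix_mult_def sum_negf)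
  have "trace ?F = trace (K ** (?H ** ?F))" by (simp add: matrix_mul_assoc K)
  also have "\<dots> = trace ((?H ** ?F) ** K)" by (rule trace_mul_sym)
  also have "(?H ** ?F) ** K = - (transpose ?F ** (?H ** K))"
    unfolding HF neg by (simp only: matrix_mul_assoc)
  also have "trace \<dots> = - trace ?F" by (simp add: K trace_def transpose_def sum_negf)
  finally show ?thesis by simp
qed

section \<open>Rules for derivatives on open sets\<close>

lemma frechet_derivative_eq_of_eq_on_open:
  assumes "(f has_derivative f') (at x)" "open D" "x \<in> D" "\<And>y. y \<in> D \<Longrightarrow> f y = g y"
  shows "frechet_derivative g (at x) = f'"
  using frechet_derivative_at[OF has_derivative_transform_within_open[OF assms]] by simp

lemma differentiable_eq_on_open:
  assumes "f differentiable (at x)" "open D" "x \<in> D" "\<And>y. y \<in> D \<Longrightarrow> f y = g y"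
  shows "g differentiable (at x)"
proof -
  obtain f' where "(f has_derivative f') (at x)" using assms(1) by (auto simp: differentiable_def)
  from has_derivative_transform_within_open[OF this assms(2-4)] show ?thesis
    by (rule differentiableI)
qed

lemma differentiable_vec:
  fixes f :: "'a::real_normed_vector \<Rightarrow> real ^ 'n"
  assumes "\<And>i. (\<lambda>y. f y $ i) differentiable (at x)"
  shows "f differentiable (at x)"
proof -
  obtain f' where "\<And>i. ((\<lambda>y. f y $ i) has_derivative f' i) (at x)"
    using assms unfolding differentiable_def by metis
  then have "((\<lambda>y. \<Sum>i\<in>UNIV. f y $ i *\<^sub>R axis i (1::real)) has_derivative
      (\<lambda>v. \<Sum>i\<in>UNIV. f' i v *\<^sub>R axis i 1)) (at x)"
    by (intro has_derivative_sum has_derivative_scaleR_left)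
  then show ?thesis
    by (simp add: basis_expansion differentiableI flip: scalar_mult_eq_scaleR)
qed

lemma differentiable_det:
  fixes M :: "'a::real_normed_vector \<Rightarrow> real ^ 'n ^ 'n"
  assumes "\<And>i j. (\<lambda>y. M y $ i $ j) differentiable (at x)"
  shows "(\<lambda>y. det (M y)) differentiable (at x)"
proof -
  obtain M' where M': "\<And>i j. ((\<lambda>y. M y $ i $ j) has_derivative M' i j) (at x)"
    using assms unfolding differentiable_def by metis
  have "(\<lambda>y. \<Prod>i\<in>UNIV. M y $ i $ p i) differentiable (at x)" for p
    by (rule differentiableI[OF has_derivative_prod[OF M']])
  show ?thesis
    unfolding det_def by (auto intro!: differentiable_sum differentiable_mult \<open>\<And>p. (\<lambda>y. \<Prod>i\<in>UNIV. M y $ i $ p i) differentiable (at x)\<close>)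
qed

section \<open>The Levi-Civita connection and its curvature in a chart\<close>

locale metric_chart =
  fixes h :: "'n::finite local_metric" and D :: "(real ^ 'n) set"
  assumes open_D: "open D"
    and scalar_product: "x \<in> D \<Longrightarrow> scalar_product (h x)"
    and smooth: "smooth_on D (\<lambda>x. h x u v)"
begin

lemmas left_linear = scalar_product_left_linear[OF scalar_product]
  and right_linear = scalar_product_right_linear[OF scalar_product]
  and metric_sym = scalar_product_sym[OF scalar_product]

lemmas metric_simps =
  linear_add[OF left_linear] linear_diff[OF left_linear] linear_scale[OF left_linear]
  linear_0[OF left_linear] linear_neg[OF left_linear]
  linear_add[OF right_linear] linear_diff[OF right_linear] linear_scale[OF right_linear]
  linear_0[OF right_linear] linear_neg[OF right_linear]

lemma metric_expand:
  assumes "x \<in> D" shows "h x v w = (\<Sum>i\<in>UNIV. v $ i * h x (axis i 1) w)"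
  using linear_real_eq_sum_axis[OF left_linear[OF assms], of v w] by simp

definition dmetric :: "real ^ 'n \<Rightarrow> real ^ 'n \<Rightarrow> real ^ 'n \<Rightarrow> real ^ 'n \<Rightarrow> real" where
  "dmetric x u v w = frechet_derivative (\<lambda>y. h y v w) (at x) u"

lemma metric_C2: "Ck_on 2 D (\<lambda>x. h x u v)"
  using smooth by (simp only: smooth_on_def)

lemma metric_has_derivative:
  assumes "x \<in> D" shows "((\<lambda>y. h y v w) has_derivative (\<lambda>u. dmetric x u v w)) (at x)"
  using metric_C2[of v w] assms unfolding dmetric_def
  by (simp add: numeral_2_eq_2 frechet_derivative_works flip: frechet_derivative_works)

lemma dmetric_differentiable:
  assumes "x \<in> D" shows "(\<lambda>y. dmetric y u v w) differentiable (at x)"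
  using metric_C2[of v w] assms unfolding dmetric_def by (simp add: numeral_2_eq_2)

text \<open>
  Expressed through the connection, this equation becomes the skewness of \<open>g(R(u,v)w,z)\<close> in \<open>w\<close> and
  \<open>z\<close>.
\<close>
lemma dmetric_commute:
  assumes "x \<in> D"
  shows "frechet_derivative (\<lambda>y. dmetric y v w z) (at x) u
       = frechet_derivative (\<lambda>y. dmetric y u w z) (at x) v"
  unfolding dmetric_def by (rule mixed_derivatives_commute[OF metric_C2 open_D assms])

lemma dmetric_linear_direction: "x \<in> D \<Longrightarrow> linear (\<lambda>u. dmetric x u v w)"
  using metric_has_derivative has_derivative_linear by blast

lemma dmetric_sym:
  assumes "x \<in> D" shows "dmetric x u v w = dmetric x u w v"
  using frechet_derivative_eq_of_eq_on_open[OF metric_has_derivative[OF assms] open_D assms,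
      of w v "\<lambda>y. h y v w"]
  by (simp add: metric_sym dmetric_def)

lemma dmetric_linear_left:
  assumes "x \<in> D" shows "linear (\<lambda>v. dmetric x u v w)"
proof (rule linearI)
  fix v v' c
  have "((\<lambda>y. h y v w + h y v' w) has_derivative (\<lambda>u. dmetric x u v w + dmetric x u v' w)) (at x)"
    by (intro has_derivative_add metric_has_derivative assms)
  from frechet_derivative_eq_of_eq_on_open[OF this open_D assms, of "\<lambda>y. h y (v + v') w"]
  show "dmetric x u (v + v') w = dmetric x u v w + dmetric x u v' w"
    by (simp add: dmetric_def[of x u "v + v'"] metric_simps)
  have "((\<lambda>y. c * h y v w) has_derivative (\<lambda>u. c * dmetric x u v w)) (at x)"
    by (intro has_derivative_mult_right metric_has_derivative assms)
  from frechet_derivative_eq_of_eq_on_open[OF this open_D assms, of "\<lambda>y. h y (c *\<^sub>R v) w"]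
  show "dmetric x u (c *\<^sub>R v) w = c *\<^sub>R dmetric x u v w"
    by (simp add: dmetric_def[of x u "c *\<^sub>R v"] metric_simps)
qed

lemma dmetric_linear_right: "x \<in> D \<Longrightarrow> linear (dmetric x u v)"
  using dmetric_linear_left[of x u v] by (simp add: dmetric_sym[of x u _ v])

text \<open>
  The right-hand side is linear in \<open>w\<close>, so that the vector which the definition of the Christoffel
  map describes exists.
\<close>
lemma koszul:
  assumes "x \<in> D"
  shows "2 * h x (christoffel h x u v) w = dmetric x u v w + dmetric x v u w - dmetric x w u v"
proof -
  let ?\<phi> = "\<lambda>w. (dmetric x u v w + dmetric x v u w - dmetric x w u v) / 2"
  have "linear ?\<phi>"
    using linear_compose_scale_right[OF linear_compose_sub[OF linear_compose_add[OF
        dmetric_linear_right[OF assms, of u v] dmetric_linear_right[OF assms, of v u]]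
        dmetric_linear_direction[OF assms, of u v]], of "1/2"]
    by simp
  from scalar_product_riesz[OF scalar_product[OF assms] this]
  have "\<exists>!z. \<forall>w. 2 * h x z w = dmetric x u v w + dmetric x v u w - dmetric x w u v"
    by (simp add: field_simps)
  from theI'[OF this] show ?thesis unfolding christoffel_def dmetric_def by blast
qed

lemma christoffel_eqI:
  assumes "x \<in> D" "\<And>w. 2 * h x z w = dmetric x u v w + dmetric x v u w - dmetric x w u v"
  shows "christoffel h x u v = z"
  by (rule scalar_product_eqI[OF scalar_product[OF assms(1)]]) (use koszul[OF assms(1), of u v] assms(2) in \<open>smt (verit)\<close>)

lemma christoffel_sym: "x \<in> D \<Longrightarrow> christoffel h x u v = christoffel h x v u"
  by (rule christoffel_eqI) (simp_all add: koszul dmetric_sym[of x _ u v])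

lemma christoffel_linear_right:
  assumes "x \<in> D" shows "linear (christoffel h x u)"
proof (rule linearI)
  note simps = assms metric_simps koszul linear_add[OF dmetric_linear_direction]
    linear_scale[OF dmetric_linear_direction] linear_add[OF dmetric_linear_right]
    linear_scale[OF dmetric_linear_right] linear_add[OF dmetric_linear_left]
    linear_scale[OF dmetric_linear_left]
  fix v v' c
  show "christoffel h x u (v + v') = christoffel h x u v + christoffel h x u v'"
    by (rule christoffel_eqI) (simp_all add: simps distrib_left)
  show "christoffel h x u (c *\<^sub>R v) = c *\<^sub>R christoffel h x u v"
    by (rule christoffel_eqI) (simp_all add: simps mult.left_commute[of 2] right_diff_distrib distrib_left)
qed

lemma christoffel_linear_left: "x \<in> D \<Longrightarrow> linear (\<lambda>u. christoffel h x u v)"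
  using christoffel_linear_right[of x v] by (simp add: christoffel_sym[of x _ v])

lemma metric_compatible:
  assumes "x \<in> D"
  shows "dmetric x u v w = h x (christoffel h x u v) w + h x v (christoffel h x u w)"
  using koszul[OF assms, of u v w] koszul[OF assms, of u w v]
    metric_sym[OF assms, of v] dmetric_sym[OF assms, of u w v]
    dmetric_sym[OF assms, of v u w] dmetric_sym[OF assms, of w u v] by simp

text \<open>
  By the Koszul formula the components of the connection solve a linear system whose matrix is the
  Gram matrix and whose right-hand side consists of first derivatives of the metric. Cramer's rule
  turns the solution into a quotient of differentiable functions.
\<close>
lemma christoffel_differentiable:
  assumes "x \<in> D" shows "(\<lambda>y. christoffel h y u v) differentiable (at x)"
proof -
  let ?b = "\<lambda>y. \<chi> i. (dmetric y u v (axis i 1) + dmetric y v u (axis i 1) - dmetric y (axis i 1) u v) / 2"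
  let ?M = "\<lambda>y k. \<chi> i j. if j = k then ?b y $ i else gram (h y) $ i $ j"
  let ?z = "\<lambda>y. \<chi> k. det (?M y k) / det (gram (h y))"
  have cramer_eq: "christoffel h y u v = ?z y" if "y \<in> D" for y
  proof -
    have "gram (h y) *v christoffel h y u v = ?b y"
      using koszul[OF that, of u v]
      by (simp add: vec_eq_iff gram_mult[OF scalar_product[OF that]] metric_sym[OF that, of "axis _ _"] mult.commute[of _ 2])
    then show ?thesis using cramer[OF gram_det_nonzero[OF scalar_product[OF that]]] by blast
  qed
  have "?z differentiable (at x)"
  proof (rule differentiable_vec)
    fix k
    have gram: "(\<lambda>y. gram (h y) $ i $ j) differentiable (at x)" for i j
      unfolding gram_def vec_lambda_beta by (rule differentiableI[OF metric_has_derivative[OF assms]])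
    have b: "(\<lambda>y. ?b y $ i) differentiable (at x)" for i
      unfolding vec_lambda_beta
      by (intro differentiable_divide differentiable_diff differentiable_add dmetric_differentiable
          differentiable_const assms) simp
    have M: "(\<lambda>y. ?M y k $ i $ j) differentiable (at x)" for i j
    proof (cases "j = k")
      case True
      show ?thesis unfolding True using b[of i] by (simp only: vec_lambda_beta if_True simp_thms)
    next
      case False
      show ?thesis using gram[of i j] by (simp only: vec_lambda_beta False if_False)
    qed
    have eq: "(\<lambda>y. ?z y $ k) = (\<lambda>y. det (?M y k) / det (gram (h y)))"
      by (rule ext, rule vec_lambda_beta)
    show "(\<lambda>y. ?z y $ k) differentiable (at x)"
      unfolding eq
      by (intro differentiable_divide differentiable_det gram gram_det_nonzero scalar_product assms M)
  qed
  from differentiable_eq_on_open[OF this open_D assms cramer_eq[symmetric]] show ?thesis .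
qed

definition dchristoffel :: "real ^ 'n \<Rightarrow> real ^ 'n \<Rightarrow> real ^ 'n \<Rightarrow> real ^ 'n \<Rightarrow> real ^ 'n" where
  "dchristoffel x u v w = frechet_derivative (\<lambda>y. christoffel h y v w) (at x) u"

lemma christoffel_has_derivative:
  assumes "x \<in> D"
  shows "((\<lambda>y. christoffel h y v w) has_derivative (\<lambda>u. dchristoffel x u v w)) (at x)"
  using christoffel_differentiable[OF assms] frechet_derivative_works
  unfolding dchristoffel_def by blast

lemma dchristoffel_sym:
  assumes "x \<in> D" shows "dchristoffel x u v w = dchristoffel x u w v"
  using frechet_derivative_eq_of_eq_on_open[OF christoffel_has_derivative[OF assms] open_D assms,
      of w v "\<lambda>y. christoffel h y v w"]
  by (simp add: christoffel_sym dchristoffel_def)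

lemma dchristoffel_linear_right:
  assumes "x \<in> D" shows "linear (dchristoffel x u v)"
proof (rule linearI)
  fix w w' c
  note simps = linear_add[OF christoffel_linear_right] linear_scale[OF christoffel_linear_right]
  have "((\<lambda>y. christoffel h y v w + christoffel h y v w') has_derivative
      (\<lambda>u. dchristoffel x u v w + dchristoffel x u v w')) (at x)"
    by (intro has_derivative_add christoffel_has_derivative assms)
  from frechet_derivative_eq_of_eq_on_open[OF this open_D assms, of "\<lambda>y. christoffel h y v (w + w')"]
  show "dchristoffel x u v (w + w') = dchristoffel x u v w + dchristoffel x u v w'"
    by (simp add: dchristoffel_def[of x u v "w + w'"] simps)
  have "((\<lambda>y. c *\<^sub>R christoffel h y v w) has_derivative (\<lambda>u. c *\<^sub>R dchristoffel x u v w)) (at x)"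
    by (intro has_derivative_scaleR_right christoffel_has_derivative assms)
  from frechet_derivative_eq_of_eq_on_open[OF this open_D assms, of "\<lambda>y. christoffel h y v (c *\<^sub>R w)"]
  show "dchristoffel x u v (c *\<^sub>R w) = c *\<^sub>R dchristoffel x u v w"
    by (simp add: dchristoffel_def[of x u v "c *\<^sub>R w"] simps)
qed

text \<open>
  For fields with constant components the covariant derivative reduces to the Christoffel map and
  the Lie bracket vanishes.
\<close>
lemma Riem_eq:
  assumes "x \<in> D"
  shows "Riem h x u v w = dchristoffel x u v w + christoffel h x u (christoffel h x v w)
       - (dchristoffel x v u w + christoffel h x v (christoffel h x u w))"
proof -
  have "cov_deriv h (\<lambda>_. a) (\<lambda>_. b) = (\<lambda>x. christoffel h x a b)" for a b
    by (simp add: cov_deriv_def fun_eq_iff)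
  then show ?thesis
    by (simp add: Riem_def curvature_field_def cov_deriv_def lie_bracket_def dchristoffel_def
        linear_0[OF christoffel_linear_left[OF assms]])
qed

lemma metric_christoffel_derivative:
  assumes "x \<in> D"
  shows "((\<lambda>y. h y (christoffel h y u v) w) has_derivative
    (\<lambda>a. dmetric x a (christoffel h x u v) w + h x (dchristoffel x a u v) w)) (at x)"
proof -
  let ?Z = "\<lambda>y. christoffel h y u v"
  have comp: "((\<lambda>y. ?Z y $ i) has_derivative (\<lambda>a. dchristoffel x a u v $ i)) (at x)" for i
    using bounded_linear.has_derivative[OF bounded_linear_vec_nth christoffel_has_derivative[OF assms]] .
  have "((\<lambda>y. \<Sum>i\<in>UNIV. ?Z y $ i * h y (axis i 1) w) has_derivative
      (\<lambda>a. \<Sum>i\<in>UNIV. ?Z x $ i * dmetric x a (axis i 1) w + dchristoffel x a u v $ i * h x (axis i 1) w))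
      (at x)"
    by (intro has_derivative_sum has_derivative_mult comp metric_has_derivative assms)
  moreover have "(\<Sum>i\<in>UNIV. ?Z x $ i * dmetric x a (axis i 1) w + dchristoffel x a u v $ i * h x (axis i 1) w)
      = dmetric x a (?Z x) w + h x (dchristoffel x a u v) w" for a
    using linear_real_eq_sum_axis[OF dmetric_linear_left[OF assms], of a "?Z x" w]
      metric_expand[OF assms, of "dchristoffel x a u v" w] by (simp add: sum.distrib)
  ultimately have "((\<lambda>y. \<Sum>i\<in>UNIV. ?Z y $ i * h y (axis i 1) w) has_derivative
      (\<lambda>a. dmetric x a (?Z x) w + h x (dchristoffel x a u v) w)) (at x)"
    by simp
  from has_derivative_transform_within_open[OF this open_D assms] show ?thesis
    using metric_expand by simp
qed

lemma second_derivative_metric: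
  assumes "x \<in> D"
  shows "frechet_derivative (\<lambda>y. dmetric y v w z) (at x) u
    = (dmetric x u (christoffel h x v w) z + h x (dchristoffel x u v w) z)
      + (dmetric x u (christoffel h x v z) w + h x (dchristoffel x u v z) w)"
proof -
  have "((\<lambda>y. h y (christoffel h y v w) z + h y (christoffel h y v z) w) has_derivative
     (\<lambda>u. (dmetric x u (christoffel h x v w) z + h x (dchristoffel x u v w) z)
      + (dmetric x u (christoffel h x v z) w + h x (dchristoffel x u v z) w))) (at x)"
    by (intro has_derivative_add metric_christoffel_derivative assms)
  from frechet_derivative_eq_of_eq_on_open[OF this open_D assms, of "\<lambda>y. dmetric y v w z"]
  show ?thesis by (simp add: metric_compatible metric_sym)
qed

lemma Riem_linear_3:
  assumes "x \<in> D" shows "linear (Riem h x u v)"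
proof -
  have "linear (\<lambda>w. Riem h x u v w)"
    unfolding Riem_eq[OF assms]
    by (intro linear_compose_sub linear_compose_add dchristoffel_linear_right
      linear_compose[OF christoffel_linear_right christoffel_linear_right, unfolded o_def] assms)
  then show ?thesis .
qed

lemma Riem_skew:
  assumes "x \<in> D" shows "Riem h x u v w = - Riem h x v u w"
  by (simp add: Riem_eq[OF assms])

text \<open>
  The symmetry of the connection in its two arguments makes all the terms cancel in pairs.
\<close>
theorem bianchi:
  assumes "x \<in> D" shows "Riem h x u v w + Riem h x v w u + Riem h x w u v = 0"
  by (simp add: Riem_eq[OF assms] dchristoffel_sym[OF assms, of _ w] dchristoffel_sym[OF assms, of _ v u]
      christoffel_sym[OF assms, of v u] christoffel_sym[OF assms, of w])

text \<open>
  The second derivatives of \<open>g(w,z)\<close> along \<open>u\<close>, \<open>v\<close> and along \<open>v\<close>, \<open>u\<close> agree. Expanding both by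
  compatibility of the connection with the metric, the terms symmetric in \<open>u\<close> and \<open>v\<close> cancel and
  \<open>g(R(u,v)w,z) + g(w,R(u,v)z)\<close> remains.
\<close>
theorem Riem_metric_skew:
  assumes "x \<in> D" shows "h x (Riem h x u v w) z = - h x w (Riem h x u v z)"
proof -
  let ?\<Gamma> = "christoffel h x" and ?d\<Gamma> = "dchristoffel x"
  have "(dmetric x u (?\<Gamma> v w) z + h x (?d\<Gamma> u v w) z) + (dmetric x u (?\<Gamma> v z) w + h x (?d\<Gamma> u v z) w)
      = (dmetric x v (?\<Gamma> u w) z + h x (?d\<Gamma> v u w) z) + (dmetric x v (?\<Gamma> u z) w + h x (?d\<Gamma> v u z) w)"
    using dmetric_commute[OF assms, of v w z u] unfolding second_derivative_metric[OF assms] .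
  then show ?thesis
    using assms by (simp add: Riem_eq metric_simps metric_compatible metric_sym[OF assms, of w]
      metric_sym[OF assms, of "?\<Gamma> u z" "?\<Gamma> v w"] metric_sym[OF assms, of "?\<Gamma> v z" "?\<Gamma> u w"])
qed

text \<open>
  The usual octahedron argument: four instances of the Bianchi identity are combined by means of
  the two skew symmetries.
\<close>
theorem Riem_pair_sym:
  assumes "x \<in> D" shows "h x (Riem h x u v w) z = h x (Riem h x w z u) v"
proof -
  have b: "h x (Riem h x p q r) t + h x (Riem h x q r p) t + h x (Riem h x r p q) t = 0" for p q r t
    using arg_cong[OF bianchi[OF assms, of p q r], of "\<lambda>y. h x y t"] assms by (simp add: metric_simps)
  have s: "h x (Riem h x p q r) t = - h x (Riem h x q p r) t" for p q r t
    by (subst Riem_skew[OF assms]) (simp add: metric_simps assms)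
  have m: "h x (Riem h x p q r) t = - h x (Riem h x p q t) r" for p q r t
    using Riem_metric_skew[OF assms, of p q r t] metric_sym[OF assms, of r] by simp
  show ?thesis
    using b[of u v w z] b[of v w z u] b[of w z u v] b[of z u v w]
      s[of w u v z] s[of u w v z] m[of u v w z] m[of v w u z] m[of w u v z] m[of v w z u] m[of w z v u] m[of z v w u]
      m[of w z u v] m[of z u w v] m[of u w z v] m[of z u v w] m[of u v z w] m[of v z u w]
      s[of v z w u] s[of z v w u] s[of u w z v] s[of w u z v] s[of w u v z] s[of v z u w] s[of z v u w]
    by linarith
qed

end

section \<open>The Ricci tensor and the nullity condition\<close>

context metric_chart
begin

lemma Ric_linear_right:
  assumes "x \<in> D" shows "linear (Ric h x v)"
  by (rule linearI)
     (simp_all add: Ric_def trace_def matrix_def linear_add[OF Riem_linear_3[OF assms]]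
       linear_scale[OF Riem_linear_3[OF assms]] sum.distrib sum_distrib_left)

text \<open>
  By the Bianchi identity the difference of the two sides is the trace of the endomorphism
  \<open>- R(v,w)\<close>, which is skew for the metric.
\<close>
lemma Ric_sym:
  assumes "x \<in> D" shows "Ric h x v w = Ric h x w v"
proof -
  have "Riem h x u v w - Riem h x u w v = - Riem h x v w u" for u
    using bianchi[OF assms, of u v w] Riem_skew[OF assms, of w u v] by (simp add: algebra_simps)
  then have "Ric h x v w - Ric h x w v = trace (matrix (\<lambda>u. - Riem h x v w u))"
    by (simp add: Ric_def flip: trace_diff)
  also have "\<dots> = 0"
    by (rule trace_skew[OF scalar_product[OF assms]])
       (simp_all add: linear_compose_neg Riem_linear_3 metric_simps Riem_metric_skew[OF assms, of v w] assms)
  finally show ?thesis by simp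
qed

lemma Ric_linear_left: "x \<in> D \<Longrightarrow> linear (\<lambda>v. Ric h x v w)"
  using Ric_linear_right[of x w] by (simp add: Ric_sym[of x _ w])

lemma metric_Ric_op:
  assumes "x \<in> D" shows "h x (Ric_op h x u) v = Ric h x u v"
  using theI'[OF scalar_product_riesz[OF scalar_product[OF assms] Ric_linear_right[OF assms, of u]]]
  unfolding Ric_op_def by blast

lemma Ric_op_linear:
  assumes "x \<in> D" shows "linear (Ric_op h x)"
  by (rule linearI; rule scalar_product_eqI[OF scalar_product[OF assms]])
     (simp_all add: assms metric_simps metric_Ric_op linear_add[OF Ric_linear_left] linear_scale[OF Ric_linear_left])

lemma Ric_op_self_adjoint: "x \<in> D \<Longrightarrow> h x (Ric_op h x u) v = h x u (Ric_op h x v)"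
  by (simp add: metric_Ric_op metric_sym[of x u] Ric_sym[of x u])

lemma metric_Ric_op_right: "x \<in> D \<Longrightarrow> h x u (Ric_op h x v) = Ric h x u v"
  by (simp add: metric_Ric_op flip: Ric_op_self_adjoint)

lemma Ric_pow_linear_right: "x \<in> D \<Longrightarrow> linear (Ric_pow h x l u)"
  unfolding Ric_pow_def by (rule right_linear)

lemma Ric_pow_Ric_op_right: "x \<in> D \<Longrightarrow> Ric_pow h x l u (Ric_op h x v) = Ric_pow h x (l + 1) u v"
  by (simp add: Ric_pow_def Ric_op_self_adjoint)

lemma Ric_pow_sym:
  assumes "x \<in> D" shows "Ric_pow h x l u v = Ric_pow h x l v u"
proof (induction l arbitrary: u v)
  case 0
  then show ?case by (simp add: Ric_pow_def metric_sym assms)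
next
  case (Suc l)
  have "Ric_pow h x (Suc l) u v = Ric_pow h x l u (Ric_op h x v)"
    by (simp add: Ric_pow_Ric_op_right assms)
  also have "\<dots> = Ric_pow h x (Suc l) v u"
    using Suc by (simp add: Ric_pow_def funpow_swap1)
  finally show ?case .
qed

lemma Ric_Ric_op_right: "x \<in> D \<Longrightarrow> Ric h x u (Ric_op h x v) = Ric_pow h x 2 u v"
  by (simp add: Ric_pow_def numeral_2_eq_2 Ric_op_self_adjoint flip: metric_Ric_op)

lemma Ric_Ric_op_left: "x \<in> D \<Longrightarrow> Ric h x (Ric_op h x u) v = Ric_pow h x 2 u v"
  by (simp add: Ric_sym[of x _ v] Ric_Ric_op_right Ric_pow_sym)

end

text \<open>
  A point \<open>x\<close> of a chart at which the unit vector \<open>\<xi>\<close> lies in the \<open>k\<close>-nullity space. The parameter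
  \<open>\<kappa> = k(n-1)\<close> is the eigenvalue of the Ricci operator at \<open>\<xi>\<close>.
\<close>
locale nullity_point = metric_chart h D
  for h :: "'n::finite local_metric" and D +
  fixes x \<xi> :: "real ^ 'n" and k \<epsilon> \<kappa> :: real
  assumes x_in: "x \<in> D"
    and nullity: "in_nullity k h x \<xi>"
    and unit: "h x \<xi> \<xi> = \<epsilon>" and sign: "\<epsilon> \<in> {1, -1}"
    and \<kappa>: "\<kappa> = k * (real CARD('n) - 1)"
begin

abbreviation G where "G \<equiv> h x"
abbreviation R where "R \<equiv> Riem h x"
abbreviation S where "S \<equiv> Ric h x"
abbreviation Q where "Q \<equiv> Ric_op h x"

lemma Riem_unit: "R u v \<xi> = k *\<^sub>R (G v \<xi> *\<^sub>R u - G u \<xi> *\<^sub>R v)"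
  using nullity by (simp add: in_nullity_def)

lemma metric_Riem_unit: "G (R u v w) \<xi> = k * (G v w * G u \<xi> - G u w * G v \<xi>)"
  using x_in
  by (subst Riem_metric_skew) (simp_all add: Riem_unit metric_simps metric_sym[of x w] algebra_simps)

text \<open>
  Pair symmetry moves \<open>\<xi>\<close> from the first to the third argument, where the nullity condition applies.
\<close>
lemma Riem_unit_left: "R \<xi> u v = k *\<^sub>R (G u v *\<^sub>R \<xi> - G v \<xi> *\<^sub>R u)"
proof (rule scalar_product_eqI[OF scalar_product[OF x_in]])
  fix z
  have "G (R \<xi> u v) z = G (R v z \<xi>) u" by (rule Riem_pair_sym[OF x_in])
  then show "G (R \<xi> u v) z = G (k *\<^sub>R (G u v *\<^sub>R \<xi> - G v \<xi> *\<^sub>R u)) z"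
    using x_in by (simp add: Riem_unit metric_simps metric_sym[of x u] metric_sym[of x \<xi> z] algebra_simps)
qed

text \<open>
  By the nullity condition the endomorphism to be traced is a multiple of the identity minus a map
  of rank one.
\<close>
lemma Ric_unit_right: "S v \<xi> = \<kappa> * G v \<xi>"
proof -
  have "S v \<xi> = trace (matrix (\<lambda>u. (k * G v \<xi>) *\<^sub>R u - (k * G u \<xi>) *\<^sub>R v))"
    by (simp add: Ric_def Riem_unit algebra_simps)
  also have "\<dots> = k * G v \<xi> * real CARD('n) - k * G v \<xi>"
    unfolding trace_diff trace_homothety
    by (subst trace_rank_one) (use linear_compose_scale_right[OF left_linear[OF x_in, of \<xi>], of k] in simp_all)
  finally show ?thesis by (simp add: \<kappa> algebra_simps)
qed

lemma metric_unit_left: "G \<xi> v = G v \<xi>"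
  using metric_sym[OF x_in] .

lemma Ric_unit_left: "S \<xi> v = \<kappa> * G v \<xi>"
  using Ric_sym[OF x_in, of \<xi> v] Ric_unit_right by simp

lemma Ric_op_unit: "Q \<xi> = \<kappa> *\<^sub>R \<xi>"
  by (rule scalar_product_eqI[OF scalar_product[OF x_in]])
     (simp add: metric_Ric_op x_in Ric_unit_left metric_simps metric_unit_left)

lemma Ric_pow_unit_left: "Ric_pow h x l \<xi> v = \<kappa> ^ l * G v \<xi>"
proof -
  have "(Q ^^ l) \<xi> = \<kappa> ^ l *\<^sub>R \<xi>"
    by (induction l) (simp_all add: Ric_op_unit linear_scale[OF Ric_op_linear[OF x_in]] mult.commute)
  then show ?thesis by (simp add: Ric_pow_def metric_simps x_in metric_unit_left)
qed

section \<open>The identity at a point\<close>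

text \<open>
  The component \<open>g(T\<^sub>b(u,v)w, \<xi>)\<close>, in which the nullity condition has removed the curvature tensor:
  it is a trilinear form built from \<open>g\<close>, \<open>S\<close> and \<open>g(\<cdot>,\<xi>)\<close>.
\<close>

definition T_unit :: "(nat \<Rightarrow> real) \<Rightarrow> real ^ 'n \<Rightarrow> real ^ 'n \<Rightarrow> real ^ 'n \<Rightarrow> real" where
  "T_unit b u v w =
     (k * b 0 + \<kappa> * b 4 + b 7 * scal h x) * G v w * G u \<xi>
     + (- k * b 0 + \<kappa> * b 5 - b 7 * scal h x) * G u w * G v \<xi>
     + \<kappa> * b 6 * G u v * G w \<xi>
     + b 1 * S v w * G u \<xi> + b 2 * S u w * G v \<xi> + b 3 * S u v * G w \<xi>"

lemma metric_Ric_op_unit: "G (Q u) \<xi> = \<kappa> * G u \<xi>"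
  by (simp add: metric_Ric_op x_in Ric_unit_right)

lemma T_curv_unit: "G (T_curv b h x u v w) \<xi> = T_unit b u v w"
  using x_in
  by (simp add: T_curv_def T_unit_def metric_simps linear_add[OF left_linear] metric_Riem_unit
      metric_Ric_op_unit algebra_simps)

lemmas Ric_simps =
  linear_add[OF Ric_linear_left] linear_scale[OF Ric_linear_left]
  linear_add[OF Ric_linear_right] linear_scale[OF Ric_linear_right]

lemma T_unit_linear:
  "linear (\<lambda>u. T_unit b u v w)" "linear (\<lambda>v. T_unit b u v w)" "linear (\<lambda>w. T_unit b u v w)"
  unfolding T_unit_def using x_in
  by (auto intro!: linearI simp: metric_simps Ric_simps distrib_left distrib_right)


text \<open>
  Both endomorphisms of the pseudosymmetry condition, \<open>T\<^sub>a(\<xi>,z)\<close> and \<open>\<xi> \<and> z\<close>, are of the shape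
  \<open>y \<mapsto> \<alpha>(y)\<xi> + g(y,\<xi>)P + c N(y)\<close>. For this shape the \<open>\<xi>\<close>-component of the derived tensor involves
  the full tensor \<open>T\<^sub>b(u,v)w\<close> only through \<open>\<alpha>\<close> and \<open>N\<close>; everything else is a value of the form
  \<open>T_unit\<close>.
\<close>
lemma derivation_inner_unit:
  fixes F N \<alpha> P c
  assumes F: "\<And>y. F y = \<alpha> y *\<^sub>R \<xi> + G y \<xi> *\<^sub>R P + c *\<^sub>R N y"
  shows "G (derivation_act F (T_curv b h x) u v w) \<xi>
    = \<epsilon> * \<alpha> (T_curv b h x u v w) + T_unit b u v w * G P \<xi> + c * G (N (T_curv b h x u v w)) \<xi>
      - (\<alpha> u * T_unit b \<xi> v w + G u \<xi> * T_unit b P v w + c * T_unit b (N u) v w)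
      - (\<alpha> v * T_unit b u \<xi> w + G v \<xi> * T_unit b u P w + c * T_unit b u (N v) w)
      - (\<alpha> w * T_unit b u v \<xi> + G w \<xi> * T_unit b u v P + c * T_unit b u v (N w))"
  using x_in
  by (simp add: derivation_act_def metric_simps T_curv_unit F unit
      linear_add[OF T_unit_linear(1)] linear_scale[OF T_unit_linear(1)]
      linear_add[OF T_unit_linear(2)] linear_scale[OF T_unit_linear(2)]
      linear_add[OF T_unit_linear(3)] linear_scale[OF T_unit_linear(3)])

text \<open>
  Needed for \<open>\<alpha> = g(z,\<cdot>)\<close>, \<open>S(z,\<cdot>)\<close> and \<open>S\<^sup>l(z,\<cdot>)\<close>: these are the terms through which the curvature
  tensor itself survives in the identity.
\<close>
lemma linear_T_curv:
  fixes \<alpha> :: "real ^ 'n \<Rightarrow> real"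
  assumes "linear \<alpha>"
  shows "\<alpha> (T_curv b h x u v w) = b 0 * \<alpha> (R u v w)
    + b 1 * S v w * \<alpha> u + b 2 * S u w * \<alpha> v + b 3 * S u v * \<alpha> w
    + b 4 * G v w * \<alpha> (Q u) + b 5 * G u w * \<alpha> (Q v) + b 6 * G u v * \<alpha> (Q w)
    + b 7 * scal h x * (G v w * \<alpha> u - G u w * \<alpha> v)"
  by (simp add: T_curv_def linear_add[OF assms] linear_diff[OF assms] linear_scale[OF assms])

lemma T_curv_unit_left:
  "T_curv a h x \<xi> z y =
     ((k * a 0 + \<kappa> * a 4 + a 7 * scal h x) * G z y + a 1 * S z y) *\<^sub>R \<xi>
     + G y \<xi> *\<^sub>R ((- k * a 0 + \<kappa> * a 2 - a 7 * scal h x) *\<^sub>R z + a 5 *\<^sub>R Q z)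
     + G z \<xi> *\<^sub>R ((\<kappa> * a 3) *\<^sub>R y + a 6 *\<^sub>R Q y)"
  by (simp add: T_curv_def Riem_unit_left Ric_unit_left metric_unit_left Ric_op_unit algebra_simps)

lemma wedge_unit_left:
  "wedge (Ric_pow h x l) \<xi> z y = Ric_pow h x l z y *\<^sub>R \<xi> + G y \<xi> *\<^sub>R (- (\<kappa> ^ l) *\<^sub>R z) + 0 *\<^sub>R y"
  by (simp add: wedge_def Ric_pow_unit_left)

end

context nullity_point
begin

text \<open>
  Rewriting with these equations turns a \<open>\<xi>\<close>-component into a polynomial in scalar products and values
  of the Ricci tensor and its powers at arguments free of \<open>Q\<close>.
\<close>

lemmas unit_component_simps =
  T_unit_def metric_simps[OF x_in] Ric_simps[OF x_in]
  linear_add[OF Ric_pow_linear_right[OF x_in]]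
  T_curv_unit unit Ric_unit_left Ric_unit_right Ric_op_unit
  metric_Ric_op[OF x_in] metric_Ric_op_right[OF x_in]
  Ric_Ric_op_left[OF x_in] Ric_Ric_op_right[OF x_in] Ric_pow_Ric_op_right[OF x_in]

end

section \<open>The identity for pseudosymmetric manifolds\<close>

theorem theorem5p4:
  fixes A :: "('m::{t2_space, second_countable_topology}, 'n::finite) chart set"
    and g :: "('m, 'n) metric"
    and \<xi> U V W X :: "('m, 'n) vfield"
    and a b :: "nat \<Rightarrow> real"
    and k \<epsilon> :: real
    and l :: nat
    and L :: "'m \<Rightarrow> real"
  assumes "N_k_xi_manifold A g k \<xi> \<epsilon>"
    and "pseudosymmetric A g a b l L"
    and "smooth_vector_field A U" and "smooth_vector_field A V"
    and "smooth_vector_field A W" and "smooth_vector_field A X"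
    and "c \<in> A" and "p \<in> fst c"
  shows "let n = real CARD('n); q = snd c p;
      u = U c q; v = V c q; w = W c q; x = X c q;
      G = g c q; R = Riem (g c) q; S = Ric (g c) q; Sp = Ric_pow (g c) q; r = scal (g c) q;
      \<eta> = (\<lambda>z. \<epsilon> * G z (\<xi> c q))
    in
      \<epsilon> * b 0 * (k * a 0 + k * (n - 1) * a 4 + a 7 * r) * G (R u v w) x
      + \<epsilon> * a 1 * b 0 * S x (R u v w)
      - 2 * k * (n - 1) * a 3 * (k * b 0 + k * (n - 1) * b 4 + b 7 * r) * \<eta> x * \<eta> u * G v w
      - 2 * k * (n - 1) * a 3 * (- k * b 0 + k * (n - 1) * b 5 - b 7 * r) * \<eta> x * \<eta> v * G u w
      + \<epsilon> * a 1 * b 4 * Sp 2 x u * G v w + \<epsilon> * a 1 * b 5 * Sp 2 x v * G u w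
      + \<epsilon> * a 1 * b 6 * Sp 2 x w * G u v
      - a 5 * (b 1 + b 3) * Sp 2 x v * \<eta> u * \<eta> w
      - a 5 * (b 1 + b 2) * Sp 2 x w * \<eta> u * \<eta> v
      - a 5 * (b 2 + b 3) * Sp 2 x u * \<eta> v * \<eta> w
      - 2 * a 6 * b 1 * Sp 2 v w * \<eta> x * \<eta> u
      - 2 * a 6 * b 2 * Sp 2 u w * \<eta> x * \<eta> v
      - 2 * a 6 * b 3 * Sp 2 u v * \<eta> x * \<eta> w
      - 2 * k ^ 2 * (n - 1) ^ 2 * a 3 * b 6 * G u v * \<eta> x * \<eta> w
      - 2 * (k * (n - 1) * a 3 * b 1 + a 6 * (k * b 0 + k * (n - 1) * b 4 + b 7 * r))
          * \<eta> x * \<eta> u * S v w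
      - 2 * (k * (n - 1) * a 3 * b 2 + a 6 * (- k * b 0 + k * (n - 1) * b 5 - b 7 * r))
          * \<eta> x * \<eta> v * S u w
      - 2 * k * (n - 1) * (a 3 * b 3 + a 6 * b 6) * S u v * \<eta> x * \<eta> w
      + \<epsilon> * (b 4 * (k * a 0 + k * (n - 1) * a 4 + a 7 * r) - a 1 * (k * b 0 + k * (n - 1) * b 4))
          * S x u * G v w
      + \<epsilon> * (b 5 * (k * a 0 + k * (n - 1) * a 4 + a 7 * r) - a 1 * (- k * b 0 + k * (n - 1) * b 5))
          * S x v * G u w
      + \<epsilon> * b 6 * (k * a 0 + k * (n - 1) * (a 4 - a 1) + a 7 * r) * S x w * G u v
      - \<epsilon> * (k * b 0 + k * (n - 1) * b 4) * (k * a 0 + k * (n - 1) * a 4 + a 7 * r) * G x u * G v w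
      - \<epsilon> * (- k * b 0 + k * (n - 1) * b 5) * (k * a 0 + k * (n - 1) * a 4 + a 7 * r) * G u w * G x v
      - \<epsilon> * k * (n - 1) * b 6 * (k * a 0 + k * (n - 1) * a 4 + a 7 * r) * G x w * G u v
      - k * (n - 1) * ((b 2 + b 3) * (k * a 0 + k * (n - 1) * a 4 + a 7 * r)
          + (a 2 + a 4) * (- k * b 0 + k * (n - 1) * (b 5 + b 6) - b 7 * r)) * G x u * \<eta> v * \<eta> w
      - k * (n - 1) * ((b 1 + b 3) * (k * a 0 + k * (n - 1) * a 4 + a 7 * r)
          + (a 2 + a 4) * (k * b 0 + k * (n - 1) * (b 4 + b 6) + b 7 * r)) * G x v * \<eta> u * \<eta> w
      - ((b 1 + b 3) * (- k * a 0 + k * (n - 1) * (a 1 + a 2) - a 7 * r)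
          + (a 1 + a 5) * (k * b 0 + k * (n - 1) * (b 4 + b 6) + b 7 * r)) * S x v * \<eta> u * \<eta> w
      - ((b 2 + b 3) * (- k * a 0 + k * (n - 1) * (a 1 + a 2) - a 7 * r)
          + (a 1 + a 5) * (- k * b 0 + k * (n - 1) * (b 5 + b 6) - b 7 * r)) * S x u * \<eta> v * \<eta> w
      - ((b 1 + b 2) * (- k * a 0 + k * (n - 1) * (a 1 + a 2) - a 7 * r)
          + k * (n - 1) * (b 4 + b 5) * (a 1 + a 5)) * S x w * \<eta> u * \<eta> v
      - k * (n - 1) * (k * (n - 1) * (b 4 + b 5) * (a 2 + a 4)
          + (b 1 + b 2) * (k * a 0 + k * (n - 1) * a 4 + a 7 * r)) * G x w * \<eta> u * \<eta> v
      =
      L p * (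
        \<epsilon> * b 0 * Sp l (R u v w) x
        + \<epsilon> * b 4 * Sp (l + 1) x u * G v w + \<epsilon> * b 5 * Sp (l + 1) x v * G u w
        + \<epsilon> * b 6 * Sp (l + 1) x w * G u v - \<epsilon> * k * (n - 1) * b 6 * Sp l x w * G u v
        + k ^ l * (n - 1) ^ l * (- k * b 0 + k * (n - 1) * (b 5 + b 6) - b 7 * r) * G x u * \<eta> v * \<eta> w
        + k ^ l * (n - 1) ^ l * (k * b 0 + k * (n - 1) * (b 4 + b 6) + b 7 * r) * G x v * \<eta> u * \<eta> w
        - (- k * b 0 + k * (n - 1) * (b 2 + b 3 + b 5 + b 6) - b 7 * r) * Sp l x u * \<eta> v * \<eta> w
        - (k * b 0 + k * (n - 1) * (b 1 + b 3 + b 4 + b 6) + b 7 * r) * Sp l x v * \<eta> u * \<eta> w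
        - k * (n - 1) * (b 1 + b 2 + b 4 + b 5) * Sp l x w * \<eta> u * \<eta> v
        + k ^ (l + 1) * (n - 1) ^ (l + 1) * (b 4 + b 5) * G x w * \<eta> u * \<eta> v
        - \<epsilon> * (- k * b 0 + k * (n - 1) * b 5) * Sp l x v * G u w
        - \<epsilon> * (k * b 0 + k * (n - 1) * b 4) * Sp l x u * G v w
        + k ^ l * (n - 1) ^ l * (b 1 + b 3) * S x v * \<eta> u * \<eta> w
        + k ^ l * (n - 1) ^ l * (b 1 + b 2) * S x w * \<eta> u * \<eta> v
        + k ^ l * (n - 1) ^ l * (b 2 + b 3) * S x u * \<eta> v * \<eta> w)"
proof -
  define q where "q = snd c p"
  have chart: "is_chart c" and metric: "semi_riemannian_metric A g"
    using assms by (auto simp: N_k_xi_manifold_def semi_riemannian_manifold_def smooth_atlas_def)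
  have q: "q \<in> chart_image c" using assms by (auto simp: q_def chart_image_def)
  interpret nullity_point "g c" "chart_image c" q "\<xi> c q" k \<epsilon> "k * (real CARD('n) - 1)"
    using assms(1,7) metric chart q
    by unfold_locales (auto simp: is_chart_def semi_riemannian_metric_def N_k_xi_manifold_def)
  define u v w z where uvwz: "u = U c q" "v = V c q" "w = W c q" "z = X c q"
  have "derivation_act (T_curv a (g c) q (\<xi> c q) z) (T_curv b (g c) q) u v w
      = L p *\<^sub>R derivation_act (wedge (Ric_pow (g c) q l) (\<xi> c q) z) (T_curv b (g c) q) u v w"
    using assms(2,7,8) by (simp add: pseudosymmetric_def Let_def q_def)
  then have unit_component:
    "G (derivation_act (T_curv a (g c) q (\<xi> c q) z) (T_curv b (g c) q) u v w) (\<xi> c q)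
      = L p * G (derivation_act (wedge (Ric_pow (g c) q l) (\<xi> c q) z) (T_curv b (g c) q) u v w) (\<xi> c q)"
    using x_in by (simp add: metric_simps)
  \<comment> \<open>The coefficient \<open>\<alpha>\<close> of \<open>\<xi>\<close> in \<open>T\<^sub>a(\<xi>,z)\<close> is a combination of \<open>g(z,\<cdot>)\<close> and \<open>S(z,\<cdot>)\<close>.\<close>
  note linear_\<alpha> = linear_compose_add[OF linear_compose_scale_right[OF right_linear[OF x_in]]
        linear_compose_scale_right[OF Ric_linear_right[OF x_in]], unfolded real_scaleR_def]
  note lhs_eq = derivation_inner_unit[where F = "T_curv a (g c) q (\<xi> c q) z" and b = b
        and u = u and v = v and w = w, OF T_curv_unit_left]
      linear_T_curv[OF linear_\<alpha>]
  note rhs_eq = derivation_inner_unit[where F = "wedge (Ric_pow (g c) q l) (\<xi> c q) z" and b = b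
        and u = u and v = v and w = w, OF wedge_unit_left]
      linear_T_curv[OF Ric_pow_linear_right[OF x_in]]
  \<comment> \<open>Symmetries are used at these arguments only, to bring equal values into the same form; as
    unrestricted rewrite rules they would not terminate.\<close>
  note sym = metric_unit_left[of u] metric_unit_left[of v] metric_unit_left[of w]
    metric_sym[OF x_in, of "R u v w" z] metric_sym[OF x_in, of u z]
    metric_sym[OF x_in, of v z] metric_sym[OF x_in, of w z]
    Ric_sym[OF x_in, of u z] Ric_sym[OF x_in, of v z] Ric_sym[OF x_in, of w z]
    Ric_pow_sym[OF x_in, of _ "R u v w" z] Ric_pow_sym[OF x_in, of _ u z]
    Ric_pow_sym[OF x_in, of _ v z] Ric_pow_sym[OF x_in, of _ w z]
  \<comment> \<open>The values of \<open>\<eta>\<close> occur in pairs, and \<open>\<eta>(s)\<eta>(t) = g(s,\<xi>)g(t,\<xi>)\<close> because \<open>\<epsilon>\<^sup>2 = 1\<close>.\<close>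
  have eta_pair: "y * (\<epsilon> * s) * (\<epsilon> * t) = y * s * t" for y s t
    using sign by auto
  note powers = power_mult_distrib power_add power_one_right
  show ?thesis
    unfolding Let_def q_def[symmetric] uvwz[symmetric]
  proof (rule trans[OF _ trans[OF unit_component]], goal_cases)
    case 1
    show ?case
      unfolding lhs_eq
      by (simp only: unit_component_simps sym real_scaleR_def, simp only: eta_pair, algebra)
  next
    case 2
    show ?case
      unfolding rhs_eq
      by (rule arg_cong[where f = "(*) (L p)"],
        simp only: unit_component_simps sym real_scaleR_def powers, simp only: eta_pair, algebra)
  qed
qed

end
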